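(* Let $S \subset \{F_i\}_{i=1}^{\infty}$ be a set of Fibonacci numbers having asymptotic density $q(S)$ in the Fibonacci numbers. For each $n$, let $m$ be an integer chosen uniformly at random from $[0, F_{n+1})$, and let $X_n(m)$ be the number of summands in the Zeckendorf decomposition of $m$ and $Y_n(m)$ the number of those summands that lie in $S$. Then for every $\varepsilon > 0$, with probability $1 + o(1)$ as $n \to \infty$, $$\left| \frac{Y_n(m)}{X_n(m)} - q(S) \right| < \varepsilon .$$
   Context: The Fibonacci numbers are normalized as $F_1 = 1$, $F_2 = 2$, $F_{n+1} = F_n + F_{n-1}$. By Zeckendorf's theorem, every positive integer $m$ can be written uniquely as a sum of non-consecutive Fibonacci numbers (its Zeckendorf decomposition). Write $\mathrm{ZD}(m)$ for the set of summands in this decomposition, with $\mathrm{ZD}(0) = \emptyset$. Thus $X_n(m) = \#\mathrm{ZD}(m)$ and $Y_n(m) = \#(\mathrm{ZD}(m) \cap S)$. For $S \subset \{F_i\}$ put $q(S,n) = \#\{ i : 1 \le i \le n,\ F_i \in S\}/n$. The asymptotic density is $q(S) = \lim_{n\to\infty} q(S,n)$, and the hypothesis is that this limit exists. "With probability $1+o(1)$" means that the proportion of integers $m \in [0, F_{n+1})$ satisfying the inequality, with $X_n(m) \ge 1$ so that the ratio is defined, tends to $1$ as $n \to \infty$. *)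

theory Defs
  imports "HOL-Number_Theory.Fib" "HOL-Probability.Probability"
begin

text \<open>The normalization is \<open>F 1 = 1\<close>, \<open>F 2 = 2\<close>, whereas the library has
  \<open>fib 1 = fib 2 = 1\<close>. Only the indices \<open>i \<ge> 1\<close> are meaningful;
  \<open>F 0 = 1\<close> is a dummy value.\<close>

definition F :: "nat \<Rightarrow> nat" where
  "F i = fib (i + 1)"

lemma F_values: "F 1 = 1" "F 2 = 2" "n \<ge> 1 \<Longrightarrow> F (n + 1) = F n + F (n - 1)"
  by (cases n; simp add: F_def numeral_2_eq_2)+

definition nonconsecutive :: "nat set \<Rightarrow> bool" where
  "nonconsecutive I \<longleftrightarrow> (\<forall>i\<in>I. Suc i \<notin> I)"

definition is_zeckendorf :: "nat set \<Rightarrow> nat \<Rightarrow> bool" where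
  "is_zeckendorf D m \<longleftrightarrow>
     (\<exists>I. finite I \<and> I \<subseteq> {1..} \<and> nonconsecutive I \<and> D = F ` I \<and> m = \<Sum>D)"

definition ZD :: "nat \<Rightarrow> nat set" where
  "ZD m = (THE D. is_zeckendorf D m)"

definition num_summands :: "nat \<Rightarrow> nat" where
  "num_summands m = card (ZD m)"

definition num_summands_in :: "nat set \<Rightarrow> nat \<Rightarrow> nat" where
  "num_summands_in S m = card (ZD m \<inter> S)"

definition fib_density_upto :: "nat set \<Rightarrow> nat \<Rightarrow> real" where
  "fib_density_upto S n = real (card {i. 1 \<le> i \<and> i \<le> n \<and> F i \<in> S}) / real n"

definition has_fib_density :: "nat set \<Rightarrow> real \<Rightarrow> bool" where
  "has_fib_density S q \<longleftrightarrow> fib_density_upto S \<longlonglongrightarrow> q"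


subsection \<open>Zeckendorf's theorem: the description defining \<open>ZD\<close> is well defined\<close>

lemma F_rec: "F (Suc (Suc n)) = F (Suc n) + F n"
  by (simp add: F_def)

lemma F_pos: "F n > 0"
  by (simp add: F_def fib_neq_0_nat)

lemma F_strict_mono: "1 \<le> i \<Longrightarrow> i < j \<Longrightarrow> F i < F j"
proof (induction j)
  case (Suc j)
  obtain k where k: "j = Suc k" using Suc.prems by (cases j) auto
  have "F j < F (Suc j)" using F_pos[of k] by (simp add: k F_rec)
  then show ?case using Suc by (cases "i = j") auto
qed simp

lemma F_inj_on: "inj_on F {1..}"
  by (rule linorder_inj_onI') (metis F_strict_mono atLeast_iff less_irrefl)

lemma index_sum_less:
  "nonconsecutive I \<Longrightarrow> I \<subseteq> {1..n} \<Longrightarrow> (\<Sum>i\<in>I. F i) < F (Suc n)"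
proof (induction n arbitrary: I rule: less_induct)
  case (less n)
  have fin: "finite I" using less.prems finite_subset by blast
  show ?case
  proof (cases "n \<in> I")
    case False
    show ?thesis
    proof (cases n)
      case 0
      then have "I = {}" using less.prems by auto
      then show ?thesis by (simp add: F_pos)
    next
      case (Suc k)
      have "I \<subseteq> {1..k}" using less.prems(2) False Suc le_Suc_eq by fastforce
      then have "(\<Sum>i\<in>I. F i) < F (Suc k)" using less Suc by blast
      also have "\<dots> \<le> F (Suc n)" by (simp add: Suc F_rec)
      finally show ?thesis .
    qed
  next
    case True
    then obtain k where k: "n = Suc k" using less.prems by (cases n) auto
    have nc: "nonconsecutive (I - {n})" using less.prems(1) by (auto simp: nonconsecutive_def)
    have "k \<notin> I" using less.prems(1) True k by (auto simp: nonconsecutive_def)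
    have sub: "I - {n} \<subseteq> {1..k - 1}"
    proof
      fix i assume i: "i \<in> I - {n}"
      then have "1 \<le> i" "i \<le> n" "i \<noteq> n" "i \<noteq> k" using less.prems(2) \<open>k \<notin> I\<close> by auto
      then show "i \<in> {1..k - 1}" using k by simp
    qed
    have "(\<Sum>i\<in>I - {n}. F i) < F (Suc (k - 1))" using less.IH[OF _ nc sub] k by simp
    also have "\<dots> \<le> F k" by (cases k) (auto simp: F_def)
    finally show ?thesis using fin True by (simp add: sum.remove k F_rec)
  qed
qed

lemma index_set_exists:
  "m < F (Suc n) \<Longrightarrow> \<exists>I. I \<subseteq> {1..n} \<and> nonconsecutive I \<and> (\<Sum>i\<in>I. F i) = m"
proof (induction n arbitrary: m rule: less_induct)
  case (less n)
  show ?case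
  proof (cases n)
    case 0
    then show ?thesis using less.prems by (intro exI[of _ "{}"]) (auto simp: F_def nonconsecutive_def)
  next
    case (Suc k)
    show ?thesis
    proof (cases "m < F n")
      case True
      then obtain I where "I \<subseteq> {1..k}" "nonconsecutive I" "(\<Sum>i\<in>I. F i) = m"
        using less.IH[of k m] Suc by auto
      then show ?thesis using Suc by (intro exI[of _ I]) auto
    next
      case False
      have "m - F n < F k" using less.prems False by (simp add: Suc F_rec)
      moreover have "F k = F (Suc (k - 1))" if "k \<noteq> 0" using that by simp
      ultimately have "m - F n < F (Suc (k - 1))" by (cases k) (auto simp: F_def)
      then obtain I where I: "I \<subseteq> {1..k - 1}" "nonconsecutive I" "(\<Sum>i\<in>I. F i) = m - F n"
        using less.IH[of "k - 1" "m - F n"] Suc by (metis diff_le_self le_imp_less_Suc)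
      have "finite I" "n \<notin> I" using I(1) Suc finite_subset by auto
      then have "(\<Sum>i\<in>insert n I. F i) = m" using I(3) False by simp
      moreover have "nonconsecutive (insert n I)"
        using I(1,2) Suc by (fastforce simp: nonconsecutive_def)
      moreover have "insert n I \<subseteq> {1..n}" using I(1) Suc by fastforce
      ultimately show ?thesis by blast
    qed
  qed
qed

lemma index_set_unique:
  assumes "nonconsecutive I" "nonconsecutive J" "I \<subseteq> {1..n}" "J \<subseteq> {1..n}"
    and "(\<Sum>i\<in>I. F i) = (\<Sum>i\<in>J. F i)"
  shows "I = J"
  using assms
proof (induction n arbitrary: I J)
  case (Suc n)
  have fin: "finite I" "finite J" using Suc.prems finite_subset by blast+
  have ge: "F (Suc n) \<le> (\<Sum>i\<in>K. F i)" if "Suc n \<in> K" "finite K" for K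
    using that by (simp add: member_le_sum)
  have lt: "K \<subseteq> {1..n}" if "Suc n \<notin> K" "K \<subseteq> {1..Suc n}" for K
    using that le_Suc_eq by fastforce
  have iff: "Suc n \<in> I \<longleftrightarrow> Suc n \<in> J"
    using ge fin lt index_sum_less Suc.prems by (metis not_less)
  show ?case
  proof (cases "Suc n \<in> I")
    case True
    have "I - {Suc n} = J - {Suc n}"
    proof (rule Suc.IH)
      show "nonconsecutive (I - {Suc n})" "nonconsecutive (J - {Suc n})"
        using Suc.prems by (auto simp: nonconsecutive_def)
      show "I - {Suc n} \<subseteq> {1..n}" "J - {Suc n} \<subseteq> {1..n}"
        using Suc.prems(3,4) le_Suc_eq by fastforce+
      show "(\<Sum>i\<in>I - {Suc n}. F i) = (\<Sum>i\<in>J - {Suc n}. F i)"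
        using Suc.prems(5) True iff fin by (simp add: sum.remove)
    qed
    then show ?thesis using True iff by blast
  next
    case False
    then show ?thesis using Suc.IH[of I J] Suc.prems lt iff by blast
  qed
qed simp

lemma sum_image_F: "I \<subseteq> {1..} \<Longrightarrow> \<Sum>(F ` I) = (\<Sum>i\<in>I. F i)"
  by (simp add: sum.reindex inj_on_subset[OF F_inj_on])

lemma ex_F_greater: "\<exists>n. m < F (Suc n)"
proof (induction m)
  case (Suc m)
  then obtain n where "m < F (Suc n)" by blast
  moreover have "F (Suc n) < F (Suc (Suc n))" by (rule F_strict_mono) auto
  ultimately show ?case by (intro exI[of _ "Suc n"]) simp
qed (use F_pos in blast)

theorem zeckendorf: "\<exists>!D. is_zeckendorf D m"
proof (rule ex_ex1I)
  obtain n where "m < F (Suc n)" using ex_F_greater by blast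
  then obtain I where I: "I \<subseteq> {1..n}" "nonconsecutive I" "(\<Sum>i\<in>I. F i) = m"
    using index_set_exists by blast
  moreover from I(1) have "finite I" "I \<subseteq> {1..}" using finite_subset by auto
  ultimately show "\<exists>D. is_zeckendorf D m"
    unfolding is_zeckendorf_def using sum_image_F by metis
next
  fix D E assume "is_zeckendorf D m" "is_zeckendorf E m"
  then obtain I J where I: "finite I" "I \<subseteq> {1..}" "nonconsecutive I" "D = F ` I" "m = \<Sum>D"
    and J: "finite J" "J \<subseteq> {1..}" "nonconsecutive J" "E = F ` J" "m = \<Sum>E"
    unfolding is_zeckendorf_def by blast
  have "I \<subseteq> {1..Max (insert 0 (I \<union> J))}" "J \<subseteq> {1..Max (insert 0 (I \<union> J))}"
    using I J by (auto simp del: Max_insert intro!: Max_ge)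
  then have "I = J" using index_set_unique I J sum_image_F by metis
  then show "D = E" using I J by simp
qed

lemma is_zeckendorf_ZD: "is_zeckendorf (ZD m) m"
  unfolding ZD_def by (rule theI'[OF zeckendorf])

lemma ZD_0: "ZD 0 = {}"
proof -
  have "is_zeckendorf {} 0" by (auto simp: is_zeckendorf_def nonconsecutive_def intro: exI[of _ "{}"])
  then show ?thesis using zeckendorf is_zeckendorf_ZD by blast
qed

end

theory Submission
  imports Defs
begin

text \<open>
  Read from the top index down, a Zeckendorf representation tiles \<open>{1..n}\<close> by single
  unused indices and by pairs consisting of a used index and the unused one below it. Weight a
  single index by \<open>1 / \<phi>\<close> and a pair by \<open>1 / \<phi>\<^sup>2\<close>, where \<open>\<phi>\<close> is the golden ratio; as
  \<open>1 / \<phi> + 1 / \<phi>\<^sup>2 = 1\<close>, this is a probability measure, and it dominates the uniform one up to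
  a factor \<open>\<phi>\<close>. Under it, the mean of an additive statistic \<open>\<Sum>i\<in>I. a i\<close> is
  \<open>(a 1 + \<dots> + a n) / (\<phi>\<^sup>2 + 1) + O(1)\<close> and its variance is \<open>O(n)\<close>, so Chebyshev's inequality
  gives a weak law of large numbers. The theorem follows by applying it to \<open>a = 1\<close> and to
  \<open>a i = 1\<^sub>S (F i) - q\<close>.
\<close>

section \<open>The golden ratio and the growth of the Fibonacci numbers\<close>

definition golden :: real where
  "golden = (1 + sqrt 5) / 2"

lemma golden_gt_1: "golden > 1"
  by (simp add: golden_def)

lemma golden_sq: "golden ^ 2 = golden + 1"
  by (simp add: golden_def power2_eq_square field_simps)

lemma golden_inverse_sum: "1 / golden + 1 / golden ^ 2 = 1"
  using golden_gt_1 golden_sq by (simp add: field_simps power2_eq_square)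

lemma golden_power_Suc_Suc: "golden ^ Suc (Suc n) = golden ^ Suc n + golden ^ n"
proof -
  have "golden ^ Suc (Suc n) = golden ^ n * golden ^ 2"
    by (simp add: power2_eq_square)
  then show ?thesis by (simp add: golden_sq algebra_simps)
qed

text \<open>Both sides obey the Fibonacci recurrence, so two initial values decide. The bound caps
  the uniform mass \<open>1 / F (Suc n)\<close> of an index set by \<open>1 / golden ^ n\<close>, as
  the comparison with the golden measure requires.\<close>

lemma golden_power_le_F: "golden ^ n \<le> F (Suc n)"
proof (induction n rule: induct_nat_012)
  case 1
  have "sqrt 5 \<le> sqrt (3 ^ 2)" by (subst real_sqrt_le_iff) simp
  then have "golden \<le> 2" by (simp add: golden_def)
  then show ?case using F_values(2) by (simp add: numeral_2_eq_2)
next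
  case (ge2 n)
  then show ?case unfolding golden_power_Suc_Suc F_rec[of "Suc n"] by simp
qed (simp add: F_def)


subsection \<open>Index sets\<close>

definition index_sets :: "nat \<Rightarrow> nat set set" where
  "index_sets n = {I. I \<subseteq> {1..n} \<and> nonconsecutive I}"

lemma finite_index_sets: "finite (index_sets n)"
  by (rule finite_subset[of _ "Pow {1..n}"]) (auto simp: index_sets_def)

lemma index_sets_nonempty: "index_sets n \<noteq> {}"
  by (auto simp: index_sets_def nonconsecutive_def)

lemma index_sets_0: "index_sets 0 = {{}}"
  by (auto simp: index_sets_def nonconsecutive_def)

text \<open>Split by whether the top index is used; if it is, its neighbour \<open>n\<close> is
  excluded. The truncated \<open>n - 1\<close> is still right for \<open>n = 0\<close>: the second
  part is then \<open>{{Suc 0}}\<close>.\<close>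

lemma index_sets_Suc:
  "index_sets (Suc n) = index_sets n \<union> insert (Suc n) ` index_sets (n - 1)"
proof (intro subset_antisym subsetI)
  fix I assume I: "I \<in> index_sets (Suc n)"
  show "I \<in> index_sets n \<union> insert (Suc n) ` index_sets (n - 1)"
  proof (cases "Suc n \<in> I")
    case True
    have "I - {Suc n} \<in> index_sets (n - 1)"
    proof -
      have "n \<notin> I" using I True by (auto simp: index_sets_def nonconsecutive_def)
      then have "i \<le> n - 1" if "i \<in> I" "i \<noteq> Suc n" for i
        using that I by (cases "i = n") (auto simp: index_sets_def dest!: subsetD)
      then show ?thesis using I by (fastforce simp: index_sets_def nonconsecutive_def)
    qed
    then have "insert (Suc n) (I - {Suc n}) \<in> insert (Suc n) ` index_sets (n - 1)"
      by (rule imageI)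
    then show ?thesis using True by (simp add: insert_absorb)
  next
    case False
    then have "I \<in> index_sets n"
      using I le_Suc_eq by (fastforce simp: index_sets_def)
    then show ?thesis by simp
  qed
next
  fix I assume "I \<in> index_sets n \<union> insert (Suc n) ` index_sets (n - 1)"
  then show "I \<in> index_sets (Suc n)"
    by (fastforce simp: index_sets_def nonconsecutive_def)
qed

lemma sum_index_sets_Suc:
  fixes f :: "nat set \<Rightarrow> real"
  shows "(\<Sum>I\<in>index_sets (Suc n). f I) =
    (\<Sum>I\<in>index_sets n. f I) + (\<Sum>I\<in>index_sets (n - 1). f (insert (Suc n) I))"
proof -
  have notin: "Suc n \<notin> I" if "I \<in> index_sets n \<union> index_sets (n - 1)" for I
    using that by (auto simp: index_sets_def)
  have "inj_on (insert (Suc n)) (index_sets (n - 1))"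
    using notin by (intro inj_onI) (metis UnI2 insert_ident)
  moreover have "index_sets n \<inter> insert (Suc n) ` index_sets (n - 1) = {}"
    using notin by blast
  ultimately show ?thesis
    by (simp add: index_sets_Suc sum.union_disjoint finite_index_sets sum.reindex)
qed

text \<open>Zeckendorf's theorem with bounded indices; it turns a uniform integer below
  \<open>F (Suc n)\<close> into a uniform index set.\<close>

lemma bij_betw_index_sets: "bij_betw (sum F) (index_sets n) {0..<F (Suc n)}"
  unfolding bij_betw_def
proof
  show "inj_on (sum F) (index_sets n)"
    unfolding index_sets_def by (rule inj_onI) (metis (lifting) index_set_unique mem_Collect_eq)
  show "sum F ` index_sets n = {0..<F (Suc n)}"
  proof (intro subset_antisym subsetI)
    fix m assume "m \<in> {0..<F (Suc n)}"
    then show "m \<in> sum F ` index_sets n"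
      using index_set_exists[of m n] by (auto simp: index_sets_def)
  qed (use index_sum_less in \<open>force simp: index_sets_def\<close>)
qed

lemma card_index_sets: "card (index_sets n) = F (Suc n)"
  using bij_betw_same_card[OF bij_betw_index_sets] by simp

lemma ZD_sum_F:
  assumes "I \<in> index_sets n"
  shows "ZD (sum F I) = F ` I"
proof -
  have "finite I" "I \<subseteq> {1..}" "nonconsecutive I"
    using assms finite_subset by (auto simp: index_sets_def)
  then have "is_zeckendorf (F ` I) (sum F I)"
    unfolding is_zeckendorf_def using sum_image_F by metis
  then show ?thesis using zeckendorf is_zeckendorf_ZD by blast
qed

lemma num_summands_sum_F:
  assumes "I \<in> index_sets n"
  shows "real (num_summands (sum F I)) = (\<Sum>i\<in>I. 1)"
    and "real (num_summands_in S (sum F I)) = (\<Sum>i\<in>I. indicator S (F i))"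
proof -
  have "I \<subseteq> {1..}" and fin: "finite I"
    using assms finite_subset by (auto simp: index_sets_def)
  then have inj: "inj_on F I" using F_inj_on inj_on_subset by blast
  show "real (num_summands (sum F I)) = (\<Sum>i\<in>I. 1)"
    by (simp add: num_summands_def ZD_sum_F[OF assms] card_image inj)
  have "F ` I \<inter> S = F ` {i \<in> I. F i \<in> S}" by auto
  then have "num_summands_in S (sum F I) = card {i \<in> I. F i \<in> S}"
    using inj by (simp add: num_summands_in_def ZD_sum_F[OF assms] card_image inj_on_subset)
  also have "real \<dots> = (\<Sum>i\<in>I. indicator S (F i))"
    using fin by (simp add: indicator_def sum.If_cases Int_def)
  finally show "real (num_summands_in S (sum F I)) = (\<Sum>i\<in>I. indicator S (F i))" .
qed


subsection \<open>The golden measure\<close>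

text \<open>The expectation of \<open>h (\<Sum>i\<in>I. a i)\<close> for a random \<open>I \<in> index_sets n\<close> distributed according
  to the golden weights. The truncated \<open>0 - 1 = 0\<close> in the case \<open>n = 0\<close> is intended: the pair used
  at index \<open>1\<close> sticks out of the interval.\<close>

fun golden_expect :: "(nat \<Rightarrow> real) \<Rightarrow> nat \<Rightarrow> (real \<Rightarrow> real) \<Rightarrow> real" where
  "golden_expect a 0 h = h 0"
| "golden_expect a (Suc n) h =
     golden_expect a n h / golden + golden_expect a (n - 1) (\<lambda>x. h (a (Suc n) + x)) / golden ^ 2"

text \<open>The increments of the expectation of \<open>\<Sum>i\<in>I. a i\<close>: the recursion is the one that makes
  their partial sums satisfy \<open>golden_mean_Suc\<close>.\<close>

fun golden_drift :: "(nat \<Rightarrow> real) \<Rightarrow> nat \<Rightarrow> real" where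
  "golden_drift a 0 = 0"
| "golden_drift a (Suc n) = (a (Suc n) - golden_drift a n) / golden ^ 2"

definition golden_mean :: "(nat \<Rightarrow> real) \<Rightarrow> nat \<Rightarrow> real" where
  "golden_mean a n = (\<Sum>i\<in>{1..n}. golden_drift a i)"

lemma golden_mean_pred: "golden_mean a (n - 1) = golden_mean a n - golden_drift a n"
  by (cases n) (simp_all add: golden_mean_def)

text \<open>\<open>golden_expect\<close> applied to the identity obeys the same recursion with the
  same value at 0, so \<open>golden_mean\<close> is the mean of the additive statistic.\<close>

lemma golden_mean_Suc:
  "golden_mean a (Suc n) =
     golden_mean a n / golden + (golden_mean a (n - 1) + a (Suc n)) / golden ^ 2"
proof -
  have "golden_mean a (Suc n) = golden_mean a n + (a (Suc n) - golden_drift a n) / golden ^ 2"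
    by (simp add: golden_mean_def)
  also have "golden_mean a n = golden_mean a n * (1 / golden + 1 / golden ^ 2)"
    by (simp only: golden_inverse_sum)
  finally show ?thesis
    unfolding golden_mean_pred by (simp add: add_divide_distrib diff_divide_distrib algebra_simps)
qed

text \<open>Sum \<open>golden ^ 2 * golden_drift a (Suc i) + golden_drift a i = a (Suc i)\<close>
  over \<open>i < n\<close>; the second terms miss only the last drift.\<close>

lemma golden_mean_eq: "(golden ^ 2 + 1) * golden_mean a n = (\<Sum>i\<in>{1..n}. a i) + golden_drift a n"
proof (induction n)
  case (Suc n)
  have "golden ^ 2 * golden_drift a (Suc n) = a (Suc n) - golden_drift a n"
    using golden_gt_1 by simp
  moreover have "golden_mean a (Suc n) = golden_mean a n + golden_drift a (Suc n)"
    by (simp add: golden_mean_def)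
  ultimately show ?case
    using Suc by (simp add: distrib_left distrib_right del: golden_drift.simps)
qed (simp add: golden_mean_def)

lemma golden_drift_bound:
  fixes B :: real
  assumes "\<And>i. \<bar>a i\<bar> \<le> B"
  shows "\<bar>golden_drift a n\<bar> \<le> B"
proof (induction n)
  case 0
  show ?case using assms[of 0] by simp
next
  case (Suc n)
  have "\<bar>golden_drift a (Suc n)\<bar> = \<bar>a (Suc n) - golden_drift a n\<bar> / golden ^ 2"
    using golden_gt_1 by simp
  also have "\<dots> \<le> (2 * B) / golden ^ 2"
    using assms[of "Suc n"] Suc by (intro divide_right_mono) auto
  \<comment> \<open>The recursion is stable because \<open>golden ^ 2 = golden + 1\<close> exceeds
    2.\<close>
  also have "\<dots> \<le> (2 * B) / 2"
    using golden_gt_1 golden_sq assms[of 0] by (intro divide_left_mono) auto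
  finally show ?case by simp
qed

text \<open>Law of total variance over the top tile: each index adds at most
  \<open>4 * B ^ 2\<close>. The centre \<open>c\<close> is arbitrary because a pair on top shifts it
  to \<open>c - a n\<close> in the induction.\<close>

lemma golden_expect_square:
  fixes B :: real
  assumes "\<And>i. \<bar>a i\<bar> \<le> B"
  shows "golden_expect a n (\<lambda>x. (x - c) ^ 2) \<le> 4 * B ^ 2 * n + (golden_mean a n - c) ^ 2"
proof (induction n arbitrary: c rule: less_induct)
  case (less n)
  show ?case
  proof (cases n)
    case 0
    then show ?thesis by (simp add: golden_mean_def)
  next
    case (Suc k)
    define r where "r = 1 / golden"
    \<comment> \<open>\<open>x\<close> and \<open>y\<close> are the conditional means given that the
      top tile is a single index or a pair.\<close>
    define x where "x = golden_mean a k"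
    define y where "y = golden_mean a (k - 1) + a n"
    have r: "0 < r" "r < 1" "r + r ^ 2 = 1"
      using golden_gt_1 golden_inverse_sum by (auto simp: r_def power_divide)
    have "\<bar>x - y\<bar> \<le> 2 * B"
      using assms[of n] golden_drift_bound[of a B k, OF assms]
      unfolding x_def y_def golden_mean_pred by linarith
    then have "(x - y) ^ 2 \<le> (2 * B) ^ 2" by (metis abs_ge_zero power2_abs power_mono)
    then have "r * r ^ 2 * (x - y) ^ 2 \<le> 1 * (2 * B) ^ 2"
      using r by (intro mult_mono mult_le_one power_le_one) auto
    \<comment> \<open>Squared bias plus variance of a variable with values \<open>x\<close> and
      \<open>y\<close>, taken with probabilities \<open>r\<close> and
      \<open>r ^ 2 = 1 - r\<close>.\<close>
    moreover have "r * (x - c) ^ 2 + r ^ 2 * (y - c) ^ 2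
      = (r * x + r ^ 2 * y - c) ^ 2 + r * r ^ 2 * (x - y) ^ 2"
    proof -
      have r2: "r ^ 2 = 1 - r" using r(3) by simp
      show ?thesis unfolding r2 by (simp add: power2_eq_square algebra_simps)
    qed
    moreover have "golden_mean a n = r * x + r ^ 2 * y"
      by (simp add: Suc golden_mean_Suc r_def x_def y_def power_divide)
    ultimately have step: "r * (x - c) ^ 2 + r ^ 2 * (y - c) ^ 2 \<le> (golden_mean a n - c) ^ 2 + 4 * B ^ 2"
      by (simp add: power_mult_distrib)
    have "golden_expect a k (\<lambda>x. (x - c) ^ 2) \<le> 4 * B ^ 2 * k + (x - c) ^ 2"
      unfolding x_def by (rule less.IH) (simp add: Suc)
    moreover have "golden_expect a (k - 1) (\<lambda>x. (a n + x - c) ^ 2) \<le> 4 * B ^ 2 * k + (y - c) ^ 2"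
    proof -
      have "golden_expect a (k - 1) (\<lambda>x. (x - (c - a n)) ^ 2)
          \<le> 4 * B ^ 2 * real (k - 1) + (golden_mean a (k - 1) - (c - a n)) ^ 2"
        by (rule less.IH) (simp add: Suc)
      also have "\<dots> \<le> 4 * B ^ 2 * k + (golden_mean a (k - 1) - (c - a n)) ^ 2"
        by (intro add_right_mono mult_left_mono) auto
      finally show ?thesis by (simp add: y_def algebra_simps)
    qed
    ultimately have "r * golden_expect a k (\<lambda>x. (x - c) ^ 2)
        + r ^ 2 * golden_expect a (k - 1) (\<lambda>x. (a n + x - c) ^ 2)
      \<le> r * (4 * B ^ 2 * k + (x - c) ^ 2) + r ^ 2 * (4 * B ^ 2 * k + (y - c) ^ 2)"
      using r by (intro add_mono mult_left_mono) auto
    also have "\<dots> = (r + r ^ 2) * (4 * B ^ 2 * k) + (r * (x - c) ^ 2 + r ^ 2 * (y - c) ^ 2)"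
      by (simp add: algebra_simps)
    also have "\<dots> \<le> 4 * B ^ 2 * k + ((golden_mean a n - c) ^ 2 + 4 * B ^ 2)"
      unfolding r(3) using step by simp
    finally show ?thesis
      by (simp add: Suc r_def power_divide algebra_simps)
  qed
qed

text \<open>The tiles of an index set have total length \<open>n\<close>, or \<open>n + 1\<close> if
  a pair sticks out below index 1, so its golden weight is at least
  \<open>1 / golden ^ Suc n\<close>.\<close>

lemma sum_index_sets_le_golden_expect:
  assumes "\<And>x. h x \<ge> 0"
  shows "golden_expect a n h \<ge> 0"
    and "(\<Sum>I\<in>index_sets n. h (sum a I)) \<le> golden ^ Suc n * golden_expect a n h"
proof -
  have "golden_expect a n h \<ge> 0 \<and>
      (\<Sum>I\<in>index_sets n. h (sum a I)) \<le> golden ^ Suc n * golden_expect a n h"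
    using assms
  proof (induction n arbitrary: h rule: less_induct)
    case (less n)
    show ?case
    proof (cases n)
      case 0
      then show ?thesis
        using less.prems[of 0] golden_gt_1 mult_right_mono[of 1 golden "h 0"]
        by (simp add: index_sets_0)
    next
      case (Suc k)
      let ?g = "\<lambda>x. h (a (Suc k) + x)"
      have IH1: "golden_expect a k h \<ge> 0"
          "(\<Sum>I\<in>index_sets k. h (sum a I)) \<le> golden ^ Suc k * golden_expect a k h"
        using less.IH[of k h] less.prems by (auto simp: Suc)
      have IH2: "golden_expect a (k - 1) ?g \<ge> 0"
          "(\<Sum>I\<in>index_sets (k - 1). ?g (sum a I)) \<le> golden ^ Suc (k - 1) * golden_expect a (k - 1) ?g"
        using less.IH[of "k - 1" ?g] less.prems by (auto simp: Suc)
      have ins: "sum a (insert (Suc k) I) = a (Suc k) + sum a I" if "I \<in> index_sets (k - 1)" for I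
      proof -
        have "finite I" "Suc k \<notin> I" using that finite_subset by (auto simp: index_sets_def)
        then show ?thesis by simp
      qed
      have "(\<Sum>I\<in>index_sets (Suc k). h (sum a I)) =
          (\<Sum>I\<in>index_sets k. h (sum a I)) + (\<Sum>I\<in>index_sets (k - 1). ?g (sum a I))"
        by (simp add: sum_index_sets_Suc ins)
      also have "\<dots> \<le> golden ^ Suc k * golden_expect a k h + golden ^ k * golden_expect a (k - 1) ?g"
      \<comment> \<open>For \<open>k = 0\<close> the induction hypothesis has exponent
        \<open>Suc (k - 1) = 1\<close> instead of \<open>k\<close>; there the sum has only the empty
        set and is evaluated directly.\<close>
      proof (cases k)
        case 0
        then show ?thesis using IH1 by (simp add: index_sets_0)
      next
        case (Suc j)
        then show ?thesis using IH1(2) IH2(2) by simp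
      qed
      also have "\<dots> = golden ^ Suc n * golden_expect a n h"
        using golden_gt_1 by (simp add: Suc field_simps power2_eq_square)
      finally show ?thesis using IH1(1) IH2(1) golden_gt_1 by (simp add: Suc)
    qed
  qed
  then show "golden_expect a n h \<ge> 0"
    and "(\<Sum>I\<in>index_sets n. h (sum a I)) \<le> golden ^ Suc n * golden_expect a n h" by auto
qed


subsection \<open>A weak law of large numbers\<close>

lemma chebyshev_index_sets:
  fixes B t :: real
  assumes "\<And>i. \<bar>a i\<bar> \<le> B" "t > 0"
  shows "measure_pmf.prob (pmf_of_set (index_sets n)) {I. \<bar>sum a I - golden_mean a n\<bar> \<ge> t}
    \<le> 4 * golden * B ^ 2 * n / t ^ 2"
proof -
  let ?h = "\<lambda>x. (x - golden_mean a n) ^ 2"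
  let ?A = "{I \<in> index_sets n. \<bar>sum a I - golden_mean a n\<bar> \<ge> t}"
  have "real (card ?A) * t ^ 2 = (\<Sum>I\<in>?A. t ^ 2)" by simp
  also have "\<dots> \<le> (\<Sum>I\<in>?A. ?h (sum a I))"
  proof (intro sum_mono)
    fix I assume "I \<in> ?A"
    then have "t ^ 2 \<le> \<bar>sum a I - golden_mean a n\<bar> ^ 2"
      using assms(2) by (intro power_mono) auto
    then show "t ^ 2 \<le> ?h (sum a I)" by simp
  qed
  also have "\<dots> \<le> (\<Sum>I\<in>index_sets n. ?h (sum a I))"
    by (intro sum_mono2) (auto simp: finite_index_sets)
  also have "\<dots> \<le> golden ^ Suc n * golden_expect a n ?h"
    by (rule sum_index_sets_le_golden_expect) simp
  also have "\<dots> \<le> golden ^ Suc n * (4 * B ^ 2 * n)"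
    using golden_expect_square[of a B n "golden_mean a n", OF assms(1)] golden_gt_1
    by (intro mult_left_mono) auto
  \<comment> \<open>The factor \<open>golden ^ n\<close> is absorbed by the number
    \<open>F (Suc n)\<close> of index sets; the remaining \<open>golden\<close> is the price of
    comparing the two measures.\<close>
  also have "\<dots> = golden ^ n * (4 * golden * B ^ 2 * n)" by simp
  also have "\<dots> \<le> F (Suc n) * (4 * golden * B ^ 2 * n)"
    using golden_power_le_F golden_gt_1 by (intro mult_right_mono) auto
  finally have "real (card ?A) / F (Suc n) \<le> 4 * golden * B ^ 2 * n / t ^ 2"
    using assms(2) F_pos[of "Suc n"]
    by (intro mult_imp_div_pos_le) (simp_all add: pos_le_divide_eq mult.commute)
  moreover have "measure_pmf.prob (pmf_of_set (index_sets n)) {I. \<bar>sum a I - golden_mean a n\<bar> \<ge> t}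
      = real (card ?A) / F (Suc n)"
    by (simp add: measure_pmf_of_set index_sets_nonempty finite_index_sets card_index_sets Int_def)
  ultimately show ?thesis by simp
qed

text \<open>Since the drift is bounded, the mean eventually lies within half the tolerance of the
  limiting centre. Chebyshev's inequality bounds the other half by \<open>O(1 / n)\<close>.\<close>

lemma weak_law_index_sets:
  fixes a :: "nat \<Rightarrow> real" and B \<alpha> \<eta> :: real
  assumes bound: "\<And>i. \<bar>a i\<bar> \<le> B"
    and avg: "(\<lambda>n. (\<Sum>i\<in>{1..n}. a i) / n) \<longlonglongrightarrow> \<alpha>"
    and "\<eta> > 0"
  shows "(\<lambda>n. measure_pmf.prob (pmf_of_set (index_sets n))
    {I. \<bar>sum a I - \<alpha> / (golden ^ 2 + 1) * n\<bar> \<ge> \<eta> * n}) \<longlonglongrightarrow> 0"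
proof -
  have drift: "(\<lambda>n. golden_drift a n / n) \<longlonglongrightarrow> 0"
  proof (rule Lim_null_comparison)
    show "\<forall>\<^sub>F n in sequentially. norm (golden_drift a n / n) \<le> B / n"
      using golden_drift_bound[OF bound] by (auto simp: divide_right_mono)
    show "(\<lambda>n. B / n) \<longlonglongrightarrow> 0" by (rule lim_const_over_n)
  qed
  have eq: "golden_mean a n / n = ((\<Sum>i\<in>{1..n}. a i) / n + golden_drift a n / n) / (golden ^ 2 + 1)" for n
  proof -
    have "golden ^ 2 + 1 > 0" by (simp add: add_nonneg_pos)
    then have "golden_mean a n = ((\<Sum>i\<in>{1..n}. a i) + golden_drift a n) / (golden ^ 2 + 1)"
      using golden_mean_eq[of a n] by (simp add: field_simps)
    then show ?thesis by (simp add: add_divide_distrib mult.commute)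
  qed
  have "(\<lambda>n. golden_mean a n / n) \<longlonglongrightarrow> (\<alpha> + 0) / (golden ^ 2 + 1)"
    unfolding eq using golden_gt_1
    by (intro tendsto_intros avg drift) (simp add: add_nonneg_eq_0_iff)
  then have "\<forall>\<^sub>F n in sequentially. \<bar>golden_mean a n / n - \<alpha> / (golden ^ 2 + 1)\<bar> < \<eta> / 2"
    using \<open>\<eta> > 0\<close> unfolding tendsto_iff dist_real_def
    by (metis add_0_right half_gt_zero)
  then have close: "\<forall>\<^sub>F n in sequentially. n > 0 \<and>
      \<bar>golden_mean a n - \<alpha> / (golden ^ 2 + 1) * n\<bar> < \<eta> / 2 * n"
    using eventually_gt_at_top[of 0]
  proof eventually_elim
    case (elim n)
    have "golden_mean a n - \<alpha> / (golden ^ 2 + 1) * n = (golden_mean a n / n - \<alpha> / (golden ^ 2 + 1)) * n"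
      using elim by (simp add: algebra_simps)
    then show ?case using elim by (simp add: abs_mult)
  qed
  show ?thesis
  proof (rule Lim_null_comparison)
    show "\<forall>\<^sub>F n in sequentially. norm (measure_pmf.prob (pmf_of_set (index_sets n))
        {I. \<bar>sum a I - \<alpha> / (golden ^ 2 + 1) * n\<bar> \<ge> \<eta> * n}) \<le> (16 * golden * B ^ 2 / \<eta> ^ 2) / n"
      using close
    proof eventually_elim
      case (elim n)
      have "{I. \<bar>sum a I - \<alpha> / (golden ^ 2 + 1) * n\<bar> \<ge> \<eta> * n}
          \<subseteq> {I. \<bar>sum a I - golden_mean a n\<bar> \<ge> \<eta> / 2 * n}"
        unfolding Collect_mono_iff using elim by (intro allI impI) linarith
      then have "measure_pmf.prob (pmf_of_set (index_sets n))
            {I. \<bar>sum a I - \<alpha> / (golden ^ 2 + 1) * n\<bar> \<ge> \<eta> * n}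
          \<le> measure_pmf.prob (pmf_of_set (index_sets n)) {I. \<bar>sum a I - golden_mean a n\<bar> \<ge> \<eta> / 2 * n}"
        by (intro measure_pmf.finite_measure_mono) auto
      also have "\<dots> \<le> 4 * golden * B ^ 2 * n / (\<eta> / 2 * n) ^ 2"
        using bound elim \<open>\<eta> > 0\<close> by (intro chebyshev_index_sets) auto
      also have "\<dots> = (16 * golden * B ^ 2 / \<eta> ^ 2) / n"
        using elim \<open>\<eta> > 0\<close> by (simp add: power2_eq_square field_simps)
      finally show ?case by simp
    qed
    show "(\<lambda>n. (16 * golden * B ^ 2 / \<eta> ^ 2) / n) \<longlonglongrightarrow> 0" by (rule lim_const_over_n)
  qed
qed

section \<open>The ratio of the summand counts\<close>

lemma sum_indicator_density:
  assumes "n > 0"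
  shows "(\<Sum>i\<in>{1..n}. indicator S (F i) - q) / n = fib_density_upto S n - q"
proof -
  have "(\<Sum>i\<in>{1..n}. indicator S (F i)) = real (card {i. 1 \<le> i \<and> i \<le> n \<and> F i \<in> S})"
    by (simp add: indicator_def sum.If_cases Int_def conj_assoc)
  then show ?thesis
    using assms by (simp add: fib_density_upto_def sum_subtractf diff_divide_distrib)
qed

theorem theorem1p1:
  fixes S :: "nat set" and q \<epsilon> :: real
  assumes "S \<subseteq> F ` {1..}"
    and "has_fib_density S q"
    and "\<epsilon> > 0"
  shows "(\<lambda>n. measure_pmf.prob (pmf_of_set {0..<F (n + 1)})
            {m. num_summands m \<ge> 1 \<and>
                \<bar>real (num_summands_in S m) / real (num_summands m) - q\<bar> < \<epsilon>})
          \<longlonglongrightarrow> 1"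
proof -
  \<comment> \<open>The limiting proportion of used indices, so that the number of summands is
    concentrated near \<open>p * n\<close>.\<close>
  define p where "p = 1 / (golden ^ 2 + 1)"
  have "p > 0" by (simp add: p_def add_nonneg_pos)
  define b :: "nat \<Rightarrow> real" where "b = (\<lambda>_. 1)"
  define a :: "nat \<Rightarrow> real" where "a = (\<lambda>i. indicator S (F i) - q)"
  define good where "good = {m. num_summands m \<ge> 1 \<and>
      \<bar>real (num_summands_in S m) / real (num_summands m) - q\<bar> < \<epsilon>}"
  define P where "P n = measure_pmf.prob (pmf_of_set (index_sets n))" for n
  \<comment> \<open>Outside \<open>few n\<close> there are more than \<open>p / 2 * n\<close>
    summands. The threshold in \<open>off n\<close> is \<open>\<epsilon>\<close> times this bound,
    so outside both events \<bar>\<open>sum a I\<close>\<bar> is below \<open>\<epsilon>\<close>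
    times the number of summands.\<close>
  define few where "few n = {I. \<bar>sum b I - p * n\<bar> \<ge> p / 2 * n}" for n :: nat
  define off where "off n = {I. \<bar>sum a I\<bar> \<ge> \<epsilon> * p / 2 * n}" for n :: nat
  have "(\<lambda>n. P n (few n)) \<longlonglongrightarrow> 0"
  proof -
    have "(\<lambda>n. (\<Sum>i\<in>{1..n}. b i) / n) \<longlonglongrightarrow> 1"
      \<comment> \<open>The average equals 1 only from \<open>n = 1\<close> on; at
        \<open>n = 0\<close> division by zero makes it 0.\<close>
      by (rule tendsto_eventually, rule eventually_sequentiallyI[of 1]) (simp add: b_def)
    from weak_law_index_sets[OF _ this, of 1 "p / 2"] \<open>p > 0\<close> show ?thesis
      by (simp add: P_def few_def b_def flip: p_def)
  qed
  moreover have "(\<lambda>n. P n (off n)) \<longlonglongrightarrow> 0"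
  proof -
    have "(\<lambda>n. fib_density_upto S n - q) \<longlonglongrightarrow> 0"
      using assms(2) by (simp add: has_fib_density_def LIM_zero)
    then have "(\<lambda>n. (\<Sum>i\<in>{1..n}. a i) / n) \<longlonglongrightarrow> 0"
      by (rule Lim_transform_eventually, intro eventually_sequentiallyI[of 1])
        (simp only: a_def sum_indicator_density[symmetric])
    moreover have "\<bar>a i\<bar> \<le> 1 + \<bar>q\<bar>" for i by (auto simp: a_def indicator_def)
    ultimately show ?thesis
      using weak_law_index_sets[of a "1 + \<bar>q\<bar>" 0 "\<epsilon> * p / 2"] \<open>p > 0\<close> \<open>\<epsilon> > 0\<close>
      by (simp add: P_def off_def)
  qed
  ultimately have "(\<lambda>n. 1 - (P n (few n) + P n (off n))) \<longlonglongrightarrow> 1 - (0 + 0)"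
    by (intro tendsto_intros)
  then have lower: "(\<lambda>n. 1 - (P n (few n) + P n (off n))) \<longlonglongrightarrow> 1" by simp
  have "measure_pmf.prob (pmf_of_set {0..<F (n + 1)}) good \<ge> 1 - (P n (few n) + P n (off n))"
    if "n > 0" for n
  proof -
    have "pmf_of_set {0..<F (n + 1)} = map_pmf (sum F) (pmf_of_set (index_sets n))"
      using map_pmf_of_set_bij_betw[OF bij_betw_index_sets index_sets_nonempty finite_index_sets]
      by simp
    then have eq: "measure_pmf.prob (pmf_of_set {0..<F (n + 1)}) good = P n (sum F -` good)"
      by (simp add: P_def)
    have "sum F I \<in> good" if I: "I \<in> index_sets n" "I \<notin> few n" "I \<notin> off n" for I
    proof -
      define X where "X = real (num_summands (sum F I))"
      define Y where "Y = real (num_summands_in S (sum F I))"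
      \<comment> \<open>Centring the weights at \<open>q\<close> makes \<open>sum a I\<close> equal
        to \<open>Y - q * X\<close>, so its quotient by \<open>X\<close> is the deviation of the
        ratio.\<close>
      have X: "X = sum b I" and Y: "Y = sum a I + q * X"
        using num_summands_sum_F[OF I(1)]
        by (simp_all add: X_def Y_def a_def b_def sum_subtractf)
      have "p * n - p / 2 * n < X"
        using I(2) unfolding few_def X mem_Collect_eq not_le by linarith
      then have large: "p / 2 * n < X" by simp
      moreover have "0 < p / 2 * n" using \<open>p > 0\<close> \<open>n > 0\<close> by simp
      ultimately have "X > 0" by linarith
      have "\<bar>sum a I\<bar> < \<epsilon> * (p / 2 * n)" using I(3) by (simp add: off_def)
      also have "\<dots> < \<epsilon> * X" using large \<open>\<epsilon> > 0\<close> by (intro mult_strict_left_mono)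
      finally have "\<bar>sum a I\<bar> < \<epsilon> * X" .
      moreover have "Y / X - q = sum a I / X" using \<open>X > 0\<close> by (simp add: Y field_simps)
      ultimately have "\<bar>Y / X - q\<bar> < \<epsilon>" using \<open>X > 0\<close> by (simp add: field_simps)
      then show ?thesis
        using \<open>X > 0\<close> by (simp add: good_def X_def Y_def)
    qed
    \<comment> \<open>The three events cover the support, which has mass 1; the union bound then
      yields the lower bound.\<close>
    then have "UNIV \<inter> set_pmf (pmf_of_set (index_sets n))
        \<subseteq> (sum F -` good \<union> (few n \<union> off n))"
      by (auto simp: finite_index_sets index_sets_nonempty)
    then have "measure_pmf.prob (pmf_of_set (index_sets n)) (UNIV \<inter> set_pmf (pmf_of_set (index_sets n)))
        \<le> P n (sum F -` good \<union> (few n \<union> off n))"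
      unfolding P_def by (intro measure_pmf.finite_measure_mono) auto
    then have "1 \<le> P n (sum F -` good \<union> (few n \<union> off n))"
      unfolding measure_Int_set_pmf by simp
    also have "\<dots> \<le> P n (sum F -` good) + P n (few n \<union> off n)"
      unfolding P_def by (rule measure_Un_le) auto
    also have "P n (few n \<union> off n) \<le> P n (few n) + P n (off n)"
      unfolding P_def by (rule measure_Un_le) auto
    finally show ?thesis using eq by simp
  qed
  then have "(\<lambda>n. measure_pmf.prob (pmf_of_set {0..<F (n + 1)}) good) \<longlonglongrightarrow> 1"
    by (intro tendsto_sandwich[OF _ _ lower tendsto_const] eventually_sequentiallyI[of 1]
        measure_pmf.prob_le_1) auto
  then show ?thesis by (simp only: good_def)
qed

end
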